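(* Let $\mathcal{G}=(G^{[1]},\dots,G^{[N]})$ be a finite time-evolving graph with positive edge weights, with global source, target and weight matrices $\mathcal{L},\mathcal{R},Z$, and let $M$ be its weighted global temporal transition matrix in the regime where backtracking in both space and time is forbidden. Let \[ \widehat{M}=\sqrt{Z}\bigl(\mathcal{R}\mathcal{L}^T-\mathcal{R}\mathcal{L}^T\circ\mathcal{L}\mathcal{R}^T\bigr)\sqrt{Z}, \] viewed as an $N\times N$ block matrix with blocks of sizes $m_{\tau_1}\times m_{\tau_2}$. Then $M$ is obtained from $\widehat{M}$ by setting all blocks strictly below the block diagonal to $0$.
   Context: All $G^{[\tau]}$ share the node set $\{1,\dots,n\}$, have no loops, and $G^{[\tau]}$ has $m_\tau$ directed edges with positive weights; edges of all time stamps are labelled jointly by $1,\dots,m$, $m=\sum_\tau m_\tau$, ordered by time stamp. $L^{[\tau]},R^{[\tau]}\in\mathbb{R}^{m_\tau\times n}$ are the source/target matrices of $G^{[\tau]}$ ($L_{ej}=1$ iff edge $e$ starts at $j$; $R_{ej}=1$ iff $e$ ends at $j$); $\mathcal{L},\mathcal{R}\in\mathbb{R}^{m\times n}$ stack $L^{[1]},\dots,L^{[N]}$ (resp. $R^{[1]},\dots,R^{[N]}$) vertically. $Z^{[\tau]}$ is the diagonal matrix of edge weights of $G^{[\tau]}$ and $Z=\operatorname{diag}(Z^{[1]},\dots,Z^{[N]})$. Let $W^{[\tau_1,\tau_2]}=Z^{[\tau_1]}R^{[\tau_1]}(L^{[\tau_2]})^TZ^{[\tau_2]}$, $W^{[\tau]}=W^{[\tau,\tau]}$,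 $B^{[\tau_1,\tau_2]}=W^{[\tau_1,\tau_2]}-(W^{[\tau_1,\tau_2]}\circ(W^{[\tau_2,\tau_1]})^T)^{\circ1/2}$, and $B^{[\tau]}_{ef}=0$ if $W^{[\tau]}_{ef}W^{[\tau]}_{fe}\ne0$, $B^{[\tau]}_{ef}=W^{[\tau]}_{ef}$ otherwise. In this regime $M$ is the elementwise square root of the block upper triangular matrix with diagonal blocks $B^{[\tau]}$, blocks $B^{[\tau_1,\tau_2]}$ in position $(\tau_1,\tau_2)$ for $\tau_1<\tau_2$, and zero blocks below the diagonal. $\circ$ is the elementwise product. *)

theory Defs
  imports Complex_Main "Jordan_Normal_Form.Matrix" "Graph_Theory.Digraph"
begin

text \<open>
  Time stamps are \<open>1, \<dots>, N\<close>; nodes, edges and matrix indices are counted from \<open>0\<close>.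
  The edges of each snapshot are labelled by \<open>0, \<dots>, m\<^sub>\<tau> - 1\<close>; the joint label of edge \<open>e\<close> of
  snapshot \<open>\<tau>\<close>, i.e. its row in the stacked matrices, is \<open>(\<Sum>\<sigma> < \<tau>. m\<^sub>\<sigma>) + e\<close>.
  Parallel edges are not excluded.
\<close>

record temporal_graph =
  node_count :: nat
  stamp_count :: nat
  snapshot :: "nat \<Rightarrow> (nat, nat) pre_digraph"
  weight :: "nat \<Rightarrow> nat \<Rightarrow> real"

definition edge_count :: "temporal_graph \<Rightarrow> nat \<Rightarrow> nat" where
  "edge_count \<G> \<tau> = card (arcs (snapshot \<G> \<tau>))"

definition time_evolving_graph :: "temporal_graph \<Rightarrow> bool" where
  "time_evolving_graph \<G> \<longleftrightarrow>
    (\<forall>\<tau>\<in>{1..stamp_count \<G>}.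
       fin_digraph (snapshot \<G> \<tau>) \<and> loopfree_digraph (snapshot \<G> \<tau>) \<and>
       verts (snapshot \<G> \<tau>) = {..<node_count \<G>} \<and>
       arcs (snapshot \<G> \<tau>) = {..<edge_count \<G> \<tau>} \<and>
       (\<forall>e\<in>arcs (snapshot \<G> \<tau>). weight \<G> \<tau> e > 0))"

definition stamps :: "temporal_graph \<Rightarrow> nat list" where
  "stamps \<G> = [1..<Suc (stamp_count \<G>)]"

definition total_edge_count :: "temporal_graph \<Rightarrow> nat" where
  "total_edge_count \<G> = (\<Sum>\<tau>=1..stamp_count \<G>. edge_count \<G> \<tau>)"

definition edge_offset :: "temporal_graph \<Rightarrow> nat \<Rightarrow> nat" where
  "edge_offset \<G> \<tau> = (\<Sum>\<sigma>=1..<\<tau>. edge_count \<G> \<sigma>)"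


definition hadamard :: "real mat \<Rightarrow> real mat \<Rightarrow> real mat" where
  "hadamard A B = mat (dim_row A) (dim_col A) (\<lambda>ij. A $$ ij * B $$ ij)"

definition stack_rows :: "nat \<Rightarrow> real mat list \<Rightarrow> real mat" where
  "stack_rows nc As = foldr append_rows As (0\<^sub>m 0 nc)"

definition append_cols :: "real mat \<Rightarrow> real mat \<Rightarrow> real mat" where
  "append_cols A B = four_block_mat A B (0\<^sub>m 0 (dim_col A)) (0\<^sub>m 0 (dim_col B))"

definition stack_cols :: "nat \<Rightarrow> real mat list \<Rightarrow> real mat" where
  "stack_cols nr As = foldr append_cols As (0\<^sub>m nr 0)"

definition block_mat :: "temporal_graph \<Rightarrow> (nat \<Rightarrow> nat \<Rightarrow> real mat) \<Rightarrow> real mat" where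
  "block_mat \<G> A =
     stack_rows (total_edge_count \<G>)
       (map (\<lambda>\<tau>\<^sub>1. stack_cols (edge_count \<G> \<tau>\<^sub>1) (map (A \<tau>\<^sub>1) (stamps \<G>))) (stamps \<G>))"

definition block :: "temporal_graph \<Rightarrow> real mat \<Rightarrow> nat \<Rightarrow> nat \<Rightarrow> real mat" where
  "block \<G> A \<tau>\<^sub>1 \<tau>\<^sub>2 = mat (edge_count \<G> \<tau>\<^sub>1) (edge_count \<G> \<tau>\<^sub>2)
     (\<lambda>(e, f). A $$ (edge_offset \<G> \<tau>\<^sub>1 + e, edge_offset \<G> \<tau>\<^sub>2 + f))"

definition zero_below_block_diag :: "temporal_graph \<Rightarrow> real mat \<Rightarrow> real mat" where
  "zero_below_block_diag \<G> A = block_mat \<G> (\<lambda>\<tau>\<^sub>1 \<tau>\<^sub>2.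
     if \<tau>\<^sub>2 < \<tau>\<^sub>1 then 0\<^sub>m (edge_count \<G> \<tau>\<^sub>1) (edge_count \<G> \<tau>\<^sub>2) else block \<G> A \<tau>\<^sub>1 \<tau>\<^sub>2)"


definition source_mat :: "temporal_graph \<Rightarrow> nat \<Rightarrow> real mat" where
  "source_mat \<G> \<tau> = mat (edge_count \<G> \<tau>) (node_count \<G>)
     (\<lambda>(e, j). if tail (snapshot \<G> \<tau>) e = j then 1 else 0)"

definition target_mat :: "temporal_graph \<Rightarrow> nat \<Rightarrow> real mat" where
  "target_mat \<G> \<tau> = mat (edge_count \<G> \<tau>) (node_count \<G>)
     (\<lambda>(e, j). if head (snapshot \<G> \<tau>) e = j then 1 else 0)"

definition weight_mat :: "temporal_graph \<Rightarrow> nat \<Rightarrow> real mat" where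
  "weight_mat \<G> \<tau> = mat_diag (edge_count \<G> \<tau>) (weight \<G> \<tau>)"

definition global_source_mat :: "temporal_graph \<Rightarrow> real mat" where
  "global_source_mat \<G> = stack_rows (node_count \<G>) (map (source_mat \<G>) (stamps \<G>))"

definition global_target_mat :: "temporal_graph \<Rightarrow> real mat" where
  "global_target_mat \<G> = stack_rows (node_count \<G>) (map (target_mat \<G>) (stamps \<G>))"

definition global_weight_mat :: "temporal_graph \<Rightarrow> real mat" where
  "global_weight_mat \<G> = diag_block_mat (map (weight_mat \<G>) (stamps \<G>))"

definition line_mat :: "temporal_graph \<Rightarrow> nat \<Rightarrow> nat \<Rightarrow> real mat" where
  "line_mat \<G> \<tau>\<^sub>1 \<tau>\<^sub>2 =
     weight_mat \<G> \<tau>\<^sub>1 * target_mat \<G> \<tau>\<^sub>1 * transpose_mat (source_mat \<G> \<tau>\<^sub>2) * weight_mat \<G> \<tau>\<^sub>2"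

definition nb_time_mat :: "temporal_graph \<Rightarrow> nat \<Rightarrow> nat \<Rightarrow> real mat" where
  "nb_time_mat \<G> \<tau>\<^sub>1 \<tau>\<^sub>2 = line_mat \<G> \<tau>\<^sub>1 \<tau>\<^sub>2 -
     map_mat sqrt (hadamard (line_mat \<G> \<tau>\<^sub>1 \<tau>\<^sub>2) (transpose_mat (line_mat \<G> \<tau>\<^sub>2 \<tau>\<^sub>1)))"

definition nb_space_mat :: "temporal_graph \<Rightarrow> nat \<Rightarrow> real mat" where
  "nb_space_mat \<G> \<tau> = mat (edge_count \<G> \<tau>) (edge_count \<G> \<tau>)
     (\<lambda>(e, f). if line_mat \<G> \<tau> \<tau> $$ (e, f) * line_mat \<G> \<tau> \<tau> $$ (f, e) \<noteq> 0 then 0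
               else line_mat \<G> \<tau> \<tau> $$ (e, f))"

definition nb_transition_mat :: "temporal_graph \<Rightarrow> real mat" where
  "nb_transition_mat \<G> = map_mat sqrt (block_mat \<G> (\<lambda>\<tau>\<^sub>1 \<tau>\<^sub>2.
     if \<tau>\<^sub>1 = \<tau>\<^sub>2 then nb_space_mat \<G> \<tau>\<^sub>1
     else if \<tau>\<^sub>1 < \<tau>\<^sub>2 then nb_time_mat \<G> \<tau>\<^sub>1 \<tau>\<^sub>2
     else 0\<^sub>m (edge_count \<G> \<tau>\<^sub>1) (edge_count \<G> \<tau>\<^sub>2)))"

text \<open>
  The factor \<open>\<surd>Z\<close> below is the square root of the matrix \<open>Z\<close>. As \<open>Z\<close> is diagonal with positive
  diagonal entries, it is obtained by taking the square root of each entry.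
\<close>

definition nb_hat_mat :: "temporal_graph \<Rightarrow> real mat" where
  "nb_hat_mat \<G> =
    (let L = global_source_mat \<G>; R = global_target_mat \<G>; sqrtZ = map_mat sqrt (global_weight_mat \<G>)
     in sqrtZ * (R * transpose_mat L - hadamard (R * transpose_mat L) (L * transpose_mat R)) * sqrtZ)"

end

theory Submission
  imports Defs
begin

text \<open>
  For an edge \<open>e\<close> of snapshot \<open>\<tau>\<^sub>1\<close> and an edge \<open>f\<close> of snapshot \<open>\<tau>\<^sub>2\<close>, with weights \<open>z\<close> and \<open>w\<close>, let
  \<open>a, b \<in> {0, 1}\<close> indicate that \<open>f\<close> starts where \<open>e\<close> ends and that \<open>e\<close> starts where \<open>f\<close> ends. Since
  \<open>(z w a) (w z b)\<close> is the square of \<open>z w a b\<close>, both definitions of the blocks of the transition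
  matrix (before the square root) give the entry \<open>z w (a - a b)\<close>, and \<open>a - a b\<close> is its own square
  root, so that \<open>M\<close> has the entry \<open>\<surd>z (a - a b) \<surd>w\<close>, which is the entry of the hat matrix.
\<close>

section \<open>Stacked and block diagonal matrices\<close>

lemma stack_rows_carrier:
  assumes "\<And>t. t \<in> set ts \<Longrightarrow> A t \<in> carrier_mat (m t) nc"
  shows "stack_rows nc (map A ts) \<in> carrier_mat (\<Sum>t\<leftarrow>ts. m t) nc"
  using assms
  by (induction ts) (auto simp: stack_rows_def intro!: carrier_append_rows)

text \<open>By induction along the list: an index either falls into the first block, or subtracting
  the height of that block leaves an index of the same kind for the rest.\<close>

lemma stack_rows_index:
  assumes "\<And>t. t \<in> set ts \<Longrightarrow> A t \<in> carrier_mat (m t) nc"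
    and "k < length ts" "e < m (ts ! k)" "j < nc"
  shows "stack_rows nc (map A ts) $$ ((\<Sum>t\<leftarrow>take k ts. m t) + e, j) = A (ts ! k) $$ (e, j)"
  using assms
proof (induction ts arbitrary: k)
  case (Cons t ts)
  have A: "A t \<in> carrier_mat (m t) nc" using Cons.prems by simp
  have S: "stack_rows nc (map A ts) \<in> carrier_mat (\<Sum>t\<leftarrow>ts. m t) nc"
    using Cons.prems by (intro stack_rows_carrier) simp
  have step: "stack_rows nc (A t # map A ts) = append_rows (A t) (stack_rows nc (map A ts))"
    by (simp add: stack_rows_def)
  show ?case
  proof (cases k)
    case 0
    then show ?thesis using Cons.prems(3,4) A S by (simp add: step append_rows_def)
  next
    case (Suc l)
    have IH: "stack_rows nc (map A ts) $$ ((\<Sum>t\<leftarrow>take l ts. m t) + e, j) = A (ts ! l) $$ (e, j)"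
      using Cons Suc by auto
    \<comment> \<open>Entries of a stacked matrix are determined only inside its dimensions, so the
      remaining index must be bounded: it lies below the end of block \<open>l\<close>, which is at
      most the height of the whole stack.\<close>
    have "(\<Sum>t\<leftarrow>take (Suc l) ts. m t) \<le> (\<Sum>t\<leftarrow>take (Suc l) ts @ drop (Suc l) ts. m t)"
      by (simp only: map_append sum_list_append)
    then have "(\<Sum>t\<leftarrow>take l ts. m t) + e < (\<Sum>t\<leftarrow>ts. m t)"
      using Cons.prems Suc by (simp add: take_Suc_conv_app_nth)
    then show ?thesis using Cons.prems(3,4) A S Suc IH by (simp add: step append_rows_def)
  qed
qed simp

text \<open>No condition such as \<open>g 0 = 0\<close> arises: the zero blocks that pad
  \<open>append_rows\<close> have width 0 and hence no entries.\<close>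

lemma map_mat_stack_rows:
  assumes "\<And>t. t \<in> set ts \<Longrightarrow> A t \<in> carrier_mat (m t) nc"
  shows "map_mat g (stack_rows nc (map A ts)) = stack_rows nc (map (\<lambda>t. map_mat g (A t)) ts)"
  using assms
proof (induction ts)
  case Nil
  show ?case by (auto simp: stack_rows_def)
next
  case (Cons t ts)
  have A: "A t \<in> carrier_mat (m t) nc" using Cons.prems by simp
  have S: "stack_rows nc (map A ts) \<in> carrier_mat (\<Sum>t\<leftarrow>ts. m t) nc"
    using Cons.prems by (intro stack_rows_carrier) simp
  have "map_mat g (append_rows (A t) (stack_rows nc (map A ts)))
      = append_rows (map_mat g (A t)) (map_mat g (stack_rows nc (map A ts)))"
    using A S by (intro eq_matI) (auto simp: append_rows_def)
  with Cons show ?case by (simp add: stack_rows_def)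
qed

lemma stack_cols_carrier:
  assumes "\<And>t. t \<in> set ts \<Longrightarrow> A t \<in> carrier_mat nr (m t)"
  shows "stack_cols nr (map A ts) \<in> carrier_mat nr (\<Sum>t\<leftarrow>ts. m t)"
  using assms
proof (induction ts)
  case (Cons t ts)
  have "A t \<in> carrier_mat nr (m t)" using Cons.prems by simp
  moreover have "stack_cols nr (map A ts) \<in> carrier_mat nr (\<Sum>t\<leftarrow>ts. m t)" using Cons by simp
  ultimately have "append_cols (A t) (stack_cols nr (map A ts)) \<in> carrier_mat nr (m t + (\<Sum>t\<leftarrow>ts. m t))"
    by (intro carrier_matI) (simp_all add: append_cols_def)
  then show ?case by (simp add: stack_cols_def)
qed (simp add: stack_cols_def)

lemma map_mat_stack_cols:
  assumes "\<And>t. t \<in> set ts \<Longrightarrow> A t \<in> carrier_mat nr (m t)"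
  shows "map_mat g (stack_cols nr (map A ts)) = stack_cols nr (map (\<lambda>t. map_mat g (A t)) ts)"
  using assms
proof (induction ts)
  case Nil
  show ?case by (auto simp: stack_cols_def)
next
  case (Cons t ts)
  have A: "A t \<in> carrier_mat nr (m t)" using Cons.prems by simp
  have S: "stack_cols nr (map A ts) \<in> carrier_mat nr (\<Sum>t\<leftarrow>ts. m t)"
    using Cons.prems by (intro stack_cols_carrier) simp
  have "map_mat g (append_cols (A t) (stack_cols nr (map A ts)))
      = append_cols (map_mat g (A t)) (map_mat g (stack_cols nr (map A ts)))"
    using A S by (intro eq_matI) (auto simp: append_cols_def)
  with Cons show ?case by (simp add: stack_cols_def)
qed

text \<open>Presents the global weight matrix as a single diagonal matrix, so that multiplying by
  its root merely scales rows and columns. The diagonal \<open>d\<close> is the concatenation of the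
  diagonals of the blocks.\<close>

lemma diag_block_mat_mat_diag:
  obtains d where
    "diag_block_mat (map (\<lambda>t. mat_diag (m t) (w t)) ts)
       = (mat_diag (\<Sum>t\<leftarrow>ts. m t) d :: 'a :: zero mat)"
    "\<And>k e. k < length ts \<Longrightarrow> e < m (ts ! k) \<Longrightarrow> d ((\<Sum>t\<leftarrow>take k ts. m t) + e) = w (ts ! k) e"
proof (induction ts arbitrary: thesis)
  case Nil
  \<comment> \<open>The matrix is 0 by 0, so any diagonal will do.\<close>
  show ?case by (rule Nil[of "\<lambda>_. 0"]) (auto simp: mat_diag_def)
next
  case (Cons t ts)
  obtain d where d: "diag_block_mat (map (\<lambda>t. mat_diag (m t) (w t)) ts)
       = mat_diag (\<Sum>t\<leftarrow>ts. m t) d"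
    and d_index: "\<And>k e. k < length ts \<Longrightarrow> e < m (ts ! k)
       \<Longrightarrow> d ((\<Sum>t\<leftarrow>take k ts. m t) + e) = w (ts ! k) e"
    using Cons.IH by blast
  define d' where "d' i = (if i < m t then w t i else d (i - m t))" for i
  show ?case
  proof (rule Cons.prems)
    show "diag_block_mat (map (\<lambda>t. mat_diag (m t) (w t)) (t # ts))
      = mat_diag (\<Sum>t\<leftarrow>t # ts. m t) d'"
      unfolding list.map diag_block_mat.simps Let_def d
      by (intro eq_matI) (auto simp: mat_diag_def d'_def)
    show "d' ((\<Sum>t\<leftarrow>take k (t # ts). m t) + e) = w ((t # ts) ! k) e"
      if "k < length (t # ts)" "e < m ((t # ts) ! k)" for k e
      using that d_index by (cases k) (auto simp: d'_def)
  qed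
qed

section \<open>Time stamps and joint edge labels\<close>

lemma set_stamps: "set (stamps \<G>) = {1..stamp_count \<G>}"
  by (auto simp: stamps_def)

lemma sum_list_stamps: "(\<Sum>t\<leftarrow>stamps \<G>. edge_count \<G> t) = total_edge_count \<G>"
  by (simp add: stamps_def total_edge_count_def interv_sum_list_conv_sum_set_nat
      atLeastLessThanSuc_atLeastAtMost del: upt_Suc)

text \<open>Stamps start at 1 and list positions at 0, so exactly \<open>\<tau> - 1\<close> stamps
  precede \<open>\<tau>\<close>.\<close>

lemma sum_list_take_stamps:
  assumes "\<tau> \<in> {1..stamp_count \<G>}"
  shows "(\<Sum>t\<leftarrow>take (\<tau> - 1) (stamps \<G>). edge_count \<G> t) = edge_offset \<G> \<tau>"
  using assms
  by (simp add: stamps_def edge_offset_def interv_sum_list_conv_sum_set_nat del: upt_Suc)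

lemma nth_stamps:
  assumes "\<tau> \<in> {1..stamp_count \<G>}"
  shows "\<tau> - 1 < length (stamps \<G>)" "stamps \<G> ! (\<tau> - 1) = \<tau>"
  using assms by (auto simp: stamps_def simp del: upt_Suc)

text \<open>Adding the whole block of \<open>\<tau>\<close> to its offset gives a partial sum of the
  edge counts up to \<open>\<tau>\<close>, which is at most the total.\<close>

lemma edge_offset_add_less:
  assumes "\<tau> \<in> {1..stamp_count \<G>}" "e < edge_count \<G> \<tau>"
  shows "edge_offset \<G> \<tau> + e < total_edge_count \<G>"
proof -
  have "edge_offset \<G> \<tau> + edge_count \<G> \<tau> = (\<Sum>\<sigma>\<in>{1..<Suc \<tau>}. edge_count \<G> \<sigma>)"
    using assms by (simp add: edge_offset_def)
  also have "\<dots> \<le> total_edge_count \<G>"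
    unfolding total_edge_count_def using assms by (intro sum_mono2) auto
  finally show ?thesis using assms by simp
qed

section \<open>Block matrices and the rows of the global matrices\<close>

lemma map_mat_block_mat:
  assumes "\<And>\<tau>\<^sub>1 \<tau>\<^sub>2. A \<tau>\<^sub>1 \<tau>\<^sub>2 \<in> carrier_mat (edge_count \<G> \<tau>\<^sub>1) (edge_count \<G> \<tau>\<^sub>2)"
  shows "map_mat g (block_mat \<G> A) = block_mat \<G> (\<lambda>\<tau>\<^sub>1 \<tau>\<^sub>2. map_mat g (A \<tau>\<^sub>1 \<tau>\<^sub>2))"
proof -
  have rows: "stack_cols (edge_count \<G> \<tau>) (map (A \<tau>) (stamps \<G>))
      \<in> carrier_mat (edge_count \<G> \<tau>) (total_edge_count \<G>)" for \<tau>
    using stack_cols_carrier[where A = "A \<tau>" and ts = "stamps \<G>", OF assms] by (simp add: sum_list_stamps)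
  have "map_mat g (stack_cols (edge_count \<G> \<tau>) (map (A \<tau>) (stamps \<G>)))
      = stack_cols (edge_count \<G> \<tau>) (map (\<lambda>\<tau>\<^sub>2. map_mat g (A \<tau> \<tau>\<^sub>2)) (stamps \<G>))" for \<tau>
    using assms by (rule map_mat_stack_cols)
  then show ?thesis
    unfolding block_mat_def by (subst map_mat_stack_rows[OF rows]) simp
qed

text \<open>The restriction to actual stamps matters because only there are the snapshots known to
  be well formed and the weights positive.\<close>

lemma block_mat_cong:
  assumes "\<And>\<tau>\<^sub>1 \<tau>\<^sub>2. \<tau>\<^sub>1 \<in> {1..stamp_count \<G>} \<Longrightarrow> \<tau>\<^sub>2 \<in> {1..stamp_count \<G>} \<Longrightarrow> A \<tau>\<^sub>1 \<tau>\<^sub>2 = B \<tau>\<^sub>1 \<tau>\<^sub>2"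
  shows "block_mat \<G> A = block_mat \<G> B"
proof -
  have "map (A \<tau>) (stamps \<G>) = map (B \<tau>) (stamps \<G>)" if "\<tau> \<in> set (stamps \<G>)" for \<tau>
    using that assms by (auto simp: set_stamps)
  then show ?thesis
    unfolding block_mat_def
    by (intro arg_cong[where f = "stack_rows _"] map_cong refl) (simp cong: map_cong)
qed

lemma stack_rows_stamps_carrier:
  assumes "\<And>\<tau>. A \<tau> \<in> carrier_mat (edge_count \<G> \<tau>) nc"
  shows "stack_rows nc (map A (stamps \<G>)) \<in> carrier_mat (total_edge_count \<G>) nc"
  using stack_rows_carrier[where A = A and m = "edge_count \<G>" and ts = "stamps \<G>", OF assms] by (simp add: sum_list_stamps)

text \<open>Whole rows are compared because the entries of \<open>R * transpose_mat L\<close> are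
  scalar products of rows; these then reduce to rows of single snapshots.\<close>

lemma stack_rows_stamps_row:
  assumes A: "\<And>\<tau>. A \<tau> \<in> carrier_mat (edge_count \<G> \<tau>) nc"
    and \<tau>: "\<tau> \<in> {1..stamp_count \<G>}" and e: "e < edge_count \<G> \<tau>"
  shows "row (stack_rows nc (map A (stamps \<G>))) (edge_offset \<G> \<tau> + e) = row (A \<tau>) e"
proof (rule eq_vecI)
  fix j assume "j < dim_vec (row (A \<tau>) e)"
  then have j: "j < nc" using A[of \<tau>] by simp
  show "row (stack_rows nc (map A (stamps \<G>))) (edge_offset \<G> \<tau> + e) $ j = row (A \<tau>) e $ j"
    using stack_rows_index[where m = "edge_count \<G>" and e = e and j = j, OF A nth_stamps(1)[OF \<tau>]]
      stack_rows_stamps_carrier[OF A] edge_offset_add_less[OF \<tau> e] A[of \<tau>] e j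
    by (simp add: nth_stamps[OF \<tau>, unfolded One_nat_def] sum_list_take_stamps[OF \<tau>, unfolded One_nat_def])
qed (use A[of \<tau>] stack_rows_stamps_carrier[OF A] in auto)

lemma source_mat_carrier: "source_mat \<G> \<tau> \<in> carrier_mat (edge_count \<G> \<tau>) (node_count \<G>)"
  by (simp add: source_mat_def)

lemma target_mat_carrier: "target_mat \<G> \<tau> \<in> carrier_mat (edge_count \<G> \<tau>) (node_count \<G>)"
  by (simp add: target_mat_def)

lemma global_source_mat_carrier:
  "global_source_mat \<G> \<in> carrier_mat (total_edge_count \<G>) (node_count \<G>)"
  unfolding global_source_mat_def by (rule stack_rows_stamps_carrier[OF source_mat_carrier])

lemma global_target_mat_carrier:
  "global_target_mat \<G> \<in> carrier_mat (total_edge_count \<G>) (node_count \<G>)"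
  unfolding global_target_mat_def by (rule stack_rows_stamps_carrier[OF target_mat_carrier])

section \<open>Entries of the line matrices and of the hat matrix\<close>

definition follows :: "temporal_graph \<Rightarrow> nat \<Rightarrow> nat \<Rightarrow> nat \<Rightarrow> nat \<Rightarrow> real" where
  "follows \<G> \<tau>\<^sub>1 e \<tau>\<^sub>2 f = of_bool (head (snapshot \<G> \<tau>\<^sub>1) e = tail (snapshot \<G> \<tau>\<^sub>2) f)"

text \<open>Each of the two rows is a unit vector marking a node. The only summand that can survive
  is the one at the head of \<open>e\<close>.\<close>

lemma target_source_scalar_prod:
  assumes "time_evolving_graph \<G>" "\<tau>\<^sub>1 \<in> {1..stamp_count \<G>}"
    "e < edge_count \<G> \<tau>\<^sub>1" "f < edge_count \<G> \<tau>\<^sub>2"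
  shows "row (target_mat \<G> \<tau>\<^sub>1) e \<bullet> row (source_mat \<G> \<tau>\<^sub>2) f = follows \<G> \<tau>\<^sub>1 e \<tau>\<^sub>2 f"
proof -
  interpret fin_digraph "snapshot \<G> \<tau>\<^sub>1"
    using assms by (auto simp: time_evolving_graph_def)
  have "head (snapshot \<G> \<tau>\<^sub>1) e \<in> verts (snapshot \<G> \<tau>\<^sub>1)"
    using assms by (intro head_in_verts) (auto simp: time_evolving_graph_def)
  \<comment> \<open>The head has to be among the nodes summed over; otherwise the sum would vanish
    even where \<open>follows\<close> is 1.\<close>
  then have head: "head (snapshot \<G> \<tau>\<^sub>1) e < node_count \<G>"
    using assms by (auto simp: time_evolving_graph_def)
  have "row (target_mat \<G> \<tau>\<^sub>1) e \<bullet> row (source_mat \<G> \<tau>\<^sub>2) f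
      = (\<Sum>j<node_count \<G>. if head (snapshot \<G> \<tau>\<^sub>1) e = j then follows \<G> \<tau>\<^sub>1 e \<tau>\<^sub>2 f else 0)"
    unfolding scalar_prod_def using assms(3,4)
    by (intro sum.cong) (simp_all add: source_mat_def target_mat_def follows_def atLeast0LessThan)
  also have "\<dots> = follows \<G> \<tau>\<^sub>1 e \<tau>\<^sub>2 f" using head by simp
  finally show ?thesis .
qed

lemma line_mat_carrier: "line_mat \<G> \<tau>\<^sub>1 \<tau>\<^sub>2 \<in> carrier_mat (edge_count \<G> \<tau>\<^sub>1) (edge_count \<G> \<tau>\<^sub>2)"
  by (intro carrier_matI) (simp_all add: line_mat_def weight_mat_def mat_diag_def)

lemma line_mat_index:
  assumes "time_evolving_graph \<G>" "\<tau>\<^sub>1 \<in> {1..stamp_count \<G>}"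
    "e < edge_count \<G> \<tau>\<^sub>1" "f < edge_count \<G> \<tau>\<^sub>2"
  shows "line_mat \<G> \<tau>\<^sub>1 \<tau>\<^sub>2 $$ (e, f) = weight \<G> \<tau>\<^sub>1 e * weight \<G> \<tau>\<^sub>2 f * follows \<G> \<tau>\<^sub>1 e \<tau>\<^sub>2 f"
proof -
  let ?P = "target_mat \<G> \<tau>\<^sub>1 * transpose_mat (source_mat \<G> \<tau>\<^sub>2)"
  have P: "?P \<in> carrier_mat (edge_count \<G> \<tau>\<^sub>1) (edge_count \<G> \<tau>\<^sub>2)"
    using target_mat_carrier[of \<G> \<tau>\<^sub>1] source_mat_carrier[of \<G> \<tau>\<^sub>2] by simp
  \<comment> \<open>Reassociated so that the two diagonal matrices stand outside, where they scale
    row \<open>e\<close> and column \<open>f\<close> of the 0/1 matrix \<open>?P\<close>.\<close>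
  have "line_mat \<G> \<tau>\<^sub>1 \<tau>\<^sub>2 = weight_mat \<G> \<tau>\<^sub>1 * ?P * weight_mat \<G> \<tau>\<^sub>2"
    unfolding line_mat_def
    by (subst assoc_mult_mat[of _ "edge_count \<G> \<tau>\<^sub>1" "edge_count \<G> \<tau>\<^sub>1" _ "node_count \<G>" _ "edge_count \<G> \<tau>\<^sub>2"])
      (simp_all add: weight_mat_def source_mat_carrier target_mat_carrier)
  then show ?thesis
    using assms P target_mat_carrier[of \<G> \<tau>\<^sub>1] source_mat_carrier[of \<G> \<tau>\<^sub>2]
    by (simp add: weight_mat_def mat_diag_mult_left[OF P] mat_diag_mult_right[of _ "edge_count \<G> \<tau>\<^sub>1"]
        target_source_scalar_prod)
qed

lemma nb_hat_mat_index:
  assumes G: "time_evolving_graph \<G>"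
    and \<tau>\<^sub>1: "\<tau>\<^sub>1 \<in> {1..stamp_count \<G>}" and \<tau>\<^sub>2: "\<tau>\<^sub>2 \<in> {1..stamp_count \<G>}"
    and e: "e < edge_count \<G> \<tau>\<^sub>1" and f: "f < edge_count \<G> \<tau>\<^sub>2"
  shows "nb_hat_mat \<G> $$ (edge_offset \<G> \<tau>\<^sub>1 + e, edge_offset \<G> \<tau>\<^sub>2 + f)
    = sqrt (weight \<G> \<tau>\<^sub>1 e) * sqrt (weight \<G> \<tau>\<^sub>2 f)
      * (follows \<G> \<tau>\<^sub>1 e \<tau>\<^sub>2 f - follows \<G> \<tau>\<^sub>1 e \<tau>\<^sub>2 f * follows \<G> \<tau>\<^sub>2 f \<tau>\<^sub>1 e)"
proof -
  let ?m = "total_edge_count \<G>" and ?L = "global_source_mat \<G>" and ?R = "global_target_mat \<G>"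
  let ?i = "edge_offset \<G> \<tau>\<^sub>1 + e" and ?j = "edge_offset \<G> \<tau>\<^sub>2 + f"
  let ?Q = "?R * transpose_mat ?L - hadamard (?R * transpose_mat ?L) (?L * transpose_mat ?R)"
  obtain d where d: "global_weight_mat \<G> = mat_diag ?m d"
    and d_index: "\<And>k e. k < length (stamps \<G>) \<Longrightarrow> e < edge_count \<G> (stamps \<G> ! k)
       \<Longrightarrow> d ((\<Sum>t\<leftarrow>take k (stamps \<G>). edge_count \<G> t) + e) = weight \<G> (stamps \<G> ! k) e"
    using diag_block_mat_mat_diag[of "edge_count \<G>" "weight \<G>" "stamps \<G>"]
    unfolding global_weight_mat_def weight_mat_def sum_list_stamps by blast
  have d_offset: "d (edge_offset \<G> \<tau> + e) = weight \<G> \<tau> e"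
    if "\<tau> \<in> {1..stamp_count \<G>}" "e < edge_count \<G> \<tau>" for \<tau> e
    using d_index[of "\<tau> - 1" e] that
    by (simp only: nth_stamps[OF that(1)] sum_list_take_stamps[OF that(1)])
  \<comment> \<open>The entrywise root is again diagonal since \<open>sqrt 0 = 0\<close>.\<close>
  have sqrtZ: "map_mat sqrt (global_weight_mat \<G>) = mat_diag ?m (\<lambda>i. sqrt (d i))"
    by (intro eq_matI) (auto simp: d mat_diag_def)
  note L = global_source_mat_carrier[of \<G>] and R = global_target_mat_carrier[of \<G>]
  note row_L = stack_rows_stamps_row[OF source_mat_carrier, folded global_source_mat_def]
    and row_R = stack_rows_stamps_row[OF target_mat_carrier, folded global_target_mat_def]
  have i: "?i < ?m" and j: "?j < ?m" using edge_offset_add_less \<tau>\<^sub>1 \<tau>\<^sub>2 e f by auto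
  have Q: "?Q \<in> carrier_mat ?m ?m" using L R by (auto simp: hadamard_def)
  have Rrow: "row ?R ?i \<bullet> row ?L ?j = follows \<G> \<tau>\<^sub>1 e \<tau>\<^sub>2 f"
    using target_source_scalar_prod[OF G \<tau>\<^sub>1 e f]
    by (simp only: row_R[OF \<tau>\<^sub>1 e] row_L[OF \<tau>\<^sub>2 f])
  \<comment> \<open>Swapping the factors puts the target row first, so the entry of
    \<open>?L * transpose_mat ?R\<close> becomes the indicator with the two edges exchanged.\<close>
  have "row ?L ?i \<bullet> row ?R ?j = row ?R ?j \<bullet> row ?L ?i"
    using L R by (intro comm_scalar_prod[of _ "node_count \<G>"] carrier_vecI) simp_all
  then have Lrow: "row ?L ?i \<bullet> row ?R ?j = follows \<G> \<tau>\<^sub>2 f \<tau>\<^sub>1 e"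
    using target_source_scalar_prod[OF G \<tau>\<^sub>2 f e]
    by (simp only: row_L[OF \<tau>\<^sub>1 e] row_R[OF \<tau>\<^sub>2 f])
  have "?Q $$ (?i, ?j) = follows \<G> \<tau>\<^sub>1 e \<tau>\<^sub>2 f - follows \<G> \<tau>\<^sub>1 e \<tau>\<^sub>2 f * follows \<G> \<tau>\<^sub>2 f \<tau>\<^sub>1 e"
    using L R i j by (simp add: hadamard_def Rrow Lrow)
  moreover have "nb_hat_mat \<G> $$ (?i, ?j) = sqrt (d ?i) * ?Q $$ (?i, ?j) * sqrt (d ?j)"
    unfolding nb_hat_mat_def Let_def sqrtZ mat_diag_mult_left[OF Q]
    by (subst mat_diag_mult_right[of _ ?m]) (use i j in auto)
  ultimately show ?thesis
    by (simp add: d_offset[OF \<tau>\<^sub>1 e] d_offset[OF \<tau>\<^sub>2 f])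
qed

section \<open>Blockwise comparison of the transition matrix with the hat matrix\<close>

theorem theorem5p6:
  fixes \<G> :: temporal_graph
  assumes "time_evolving_graph \<G>"
  shows "nb_transition_mat \<G> = zero_below_block_diag \<G> (nb_hat_mat \<G>)"
proof -
  let ?A = "\<lambda>\<tau>\<^sub>1 \<tau>\<^sub>2. if \<tau>\<^sub>1 = \<tau>\<^sub>2 then nb_space_mat \<G> \<tau>\<^sub>1
     else if \<tau>\<^sub>1 < \<tau>\<^sub>2 then nb_time_mat \<G> \<tau>\<^sub>1 \<tau>\<^sub>2
     else 0\<^sub>m (edge_count \<G> \<tau>\<^sub>1) (edge_count \<G> \<tau>\<^sub>2)"
  have time_carrier: "nb_time_mat \<G> \<tau>\<^sub>1 \<tau>\<^sub>2 \<in> carrier_mat (edge_count \<G> \<tau>\<^sub>1) (edge_count \<G> \<tau>\<^sub>2)" for \<tau>\<^sub>1 \<tau>\<^sub>2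
    using line_mat_carrier[of \<G> \<tau>\<^sub>1 \<tau>\<^sub>2] by (auto simp: nb_time_mat_def hadamard_def)
  have carrier: "?A \<tau>\<^sub>1 \<tau>\<^sub>2 \<in> carrier_mat (edge_count \<G> \<tau>\<^sub>1) (edge_count \<G> \<tau>\<^sub>2)" for \<tau>\<^sub>1 \<tau>\<^sub>2
    using time_carrier by (auto simp: nb_space_mat_def)
  have pos: "weight \<G> \<tau> e > 0" if "\<tau> \<in> {1..stamp_count \<G>}" "e < edge_count \<G> \<tau>" for \<tau> e
    using assms that by (auto simp: time_evolving_graph_def)
  \<comment> \<open>The outer root acts block by block, so it suffices to compare the blocks for
    actual stamps.\<close>
  have "map_mat sqrt (?A \<tau>\<^sub>1 \<tau>\<^sub>2)
      = (if \<tau>\<^sub>2 < \<tau>\<^sub>1 then 0\<^sub>m (edge_count \<G> \<tau>\<^sub>1) (edge_count \<G> \<tau>\<^sub>2) else block \<G> (nb_hat_mat \<G>) \<tau>\<^sub>1 \<tau>\<^sub>2)"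
    (is "_ = ?B")
    if \<tau>\<^sub>1: "\<tau>\<^sub>1 \<in> {1..stamp_count \<G>}" and \<tau>\<^sub>2: "\<tau>\<^sub>2 \<in> {1..stamp_count \<G>}" for \<tau>\<^sub>1 \<tau>\<^sub>2
  proof (rule eq_matI)
    fix e f
    assume "e < dim_row ?B" "f < dim_col ?B"
    then have e: "e < edge_count \<G> \<tau>\<^sub>1" and f: "f < edge_count \<G> \<tau>\<^sub>2"
      by (auto simp: block_def split: if_splits)
    note W = line_mat_index[OF assms \<tau>\<^sub>1 e f] line_mat_index[OF assms \<tau>\<^sub>2 f e]
    let ?z = "weight \<G> \<tau>\<^sub>1 e" and ?w = "weight \<G> \<tau>\<^sub>2 f"
    note zw = pos[OF \<tau>\<^sub>1 e] pos[OF \<tau>\<^sub>2 f]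
    \<comment> \<open>This is the root in \<open>nb_time_mat\<close> when both indicators are 1;
      positivity of the weights selects the root \<open>?z * ?w\<close>.\<close>
    have sq: "sqrt (?z * ?w * (?w * ?z)) = ?z * ?w"
      using zw by (intro real_sqrt_unique) (auto simp: power2_eq_square)
    consider "\<tau>\<^sub>2 < \<tau>\<^sub>1" | "\<tau>\<^sub>1 = \<tau>\<^sub>2" | "\<tau>\<^sub>1 < \<tau>\<^sub>2" by linarith
    then show "map_mat sqrt (?A \<tau>\<^sub>1 \<tau>\<^sub>2) $$ (e, f) = ?B $$ (e, f)"
    proof cases
      case 1
      \<comment> \<open>The zero blocks survive the root because \<open>sqrt 0 = 0\<close>.\<close>
      then show ?thesis using e f by simp
    next
      case 2
      \<comment> \<open>As the weights are positive, the product tested in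
        \<open>nb_space_mat\<close> is nonzero exactly when both indicators are 1, and then their
        difference term is 0. Otherwise the product of the indicators vanishes and the entry of the
        line matrix remains.\<close>
      then have "nb_space_mat \<G> \<tau>\<^sub>1 $$ (e, f)
          = ?z * ?w * (follows \<G> \<tau>\<^sub>1 e \<tau>\<^sub>2 f - follows \<G> \<tau>\<^sub>1 e \<tau>\<^sub>2 f * follows \<G> \<tau>\<^sub>2 f \<tau>\<^sub>1 e)"
        using e f zw W by (simp add: nb_space_mat_def follows_def)
      then have "map_mat sqrt (?A \<tau>\<^sub>1 \<tau>\<^sub>2) $$ (e, f) = nb_hat_mat \<G> $$ (edge_offset \<G> \<tau>\<^sub>1 + e, edge_offset \<G> \<tau>\<^sub>2 + f)"
        unfolding nb_hat_mat_index[OF assms \<tau>\<^sub>1 \<tau>\<^sub>2 e f]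
        using 2 e f carrier[of \<tau>\<^sub>1 \<tau>\<^sub>2] by (simp add: follows_def real_sqrt_mult)
      then show ?thesis using 2 e f by (simp add: block_def)
    next
      case 3
      \<comment> \<open>If either indicator is 0, the root is 0 and nothing is subtracted; if both
        are 1, \<open>sq\<close> makes the subtracted term cancel the entry.\<close>
      have "nb_time_mat \<G> \<tau>\<^sub>1 \<tau>\<^sub>2 $$ (e, f)
          = ?z * ?w * (follows \<G> \<tau>\<^sub>1 e \<tau>\<^sub>2 f - follows \<G> \<tau>\<^sub>1 e \<tau>\<^sub>2 f * follows \<G> \<tau>\<^sub>2 f \<tau>\<^sub>1 e)"
        using e f line_mat_carrier[of \<G> \<tau>\<^sub>1 \<tau>\<^sub>2] line_mat_carrier[of \<G> \<tau>\<^sub>2 \<tau>\<^sub>1]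
        by (auto simp: nb_time_mat_def hadamard_def W follows_def sq)
      then show ?thesis using 3 e f time_carrier[of \<tau>\<^sub>1 \<tau>\<^sub>2]
        by (auto simp: block_def nb_hat_mat_index[OF assms \<tau>\<^sub>1 \<tau>\<^sub>2 e f] follows_def real_sqrt_mult)
    qed
  qed (use carrier[of \<tau>\<^sub>1 \<tau>\<^sub>2] in \<open>auto simp: block_def split: if_splits\<close>)
  then show ?thesis
    unfolding nb_transition_mat_def zero_below_block_diag_def map_mat_block_mat[OF carrier]
    by (rule block_mat_cong)
qed

end
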